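(* Let $K$ be a field, let $S=\bigcup_{k=1}^{\infty}\{10^kn+k-1 \mid n=1,2,\dots\}\subseteq\mathbb N$, and let $A=K\langle x_1,x_2,x_3\rangle/I$, where $I$ is the ideal generated by all monomials which are not factors of any infinite word of the form $x_{\epsilon_1}x_{\epsilon_2}x_{\epsilon_3}\cdots$ with $\epsilon_i\in\{1,2,3\}$ such that, for all $i\geq1$, $\epsilon_i=1$ if and only if $i\in S$. Then $A$ is a monomial algebra of exponential growth that contains no noncommutative free subalgebras.
   Context: Algebras are associative and unital. A monomial algebra over $K$ is a quotient of a free algebra $K\langle x_1,\dots,x_d\rangle$ by an ideal generated by monomials (words in the generators). A factor of a word is a finite contiguous subword. A finitely generated algebra $A$ has exponential growth if $\dim_K V^n$ grows exponentially in $n$ (at least $\beta^n$ for some $\beta>1$ and all large $n$), for a finite-dimensional generating subspace $V\ni1$. A noncommutative free subalgebra is a subalgebra that is a free associative $K$-algebra on at least two generators. *)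

theory Defs
  imports
    "HOL-Algebra.Algebra"
    "HOL-Algebra.Algebraic_Closure_Type"
    "HOL-Library.Poly_Mapping"
begin

text \<open>
  A \<open>K\<close>-algebra over a field \<open>K\<close>, given as a type \<open>'k :: field\<close>, is a \<^typ>\<open>('k, 'a) module\<close>
  record: its ring operations together with the scalar multiplication.
\<close>

section \<open>Algebras over a field\<close>

definition alg_iso ::
  "('k::field, 'a, 'm) module_scheme \<Rightarrow> ('k, 'b, 'n) module_scheme \<Rightarrow> ('a \<Rightarrow> 'b) set" where
  "alg_iso A B =
     {h \<in> ring_iso A B. \<forall>c. \<forall>a \<in> carrier A. h (c \<odot>\<^bsub>A\<^esub> a) = c \<odot>\<^bsub>B\<^esub> h a}"

definition subspace_of :: "'a set \<Rightarrow> ('k::field, 'a, 'm) module_scheme \<Rightarrow> bool" where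
  "subspace_of W A \<longleftrightarrow> submodule W (ring_of_type_algebra :: 'k ring) A"

definition subalgebra_of :: "'a set \<Rightarrow> ('k::field, 'a, 'm) module_scheme \<Rightarrow> bool" where
  "subalgebra_of B A \<longleftrightarrow> subring B A \<and> (\<forall>c. \<forall>b \<in> B. c \<odot>\<^bsub>A\<^esub> b \<in> B)"

definition lin_span :: "('k::field, 'a, 'm) module_scheme \<Rightarrow> 'a set \<Rightarrow> 'a set" where
  "lin_span A T = \<Inter>{W. subspace_of W A \<and> T \<subseteq> W}"

definition alg_generated :: "('k::field, 'a, 'm) module_scheme \<Rightarrow> 'a set \<Rightarrow> 'a set" where
  "alg_generated A T = \<Inter>{B. subalgebra_of B A \<and> T \<subseteq> B}"

text \<open>
  The library's \<^const>\<open>ring.dimension\<close> is the dimension over a subfield contained in the ring,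
  acting by multiplication. In an algebra \<open>c \<odot> a = (c \<odot> \<one>) \<otimes> a\<close>, so the dimension over \<open>K\<close>
  is the one over the subfield \<open>K \<odot> \<one>\<close>.
\<close>

definition has_dim :: "('k::field, 'a, 'm) module_scheme \<Rightarrow> 'a set \<Rightarrow> nat \<Rightarrow> bool" where
  "has_dim A W m \<longleftrightarrow> ring.dimension A m (range (\<lambda>c. c \<odot>\<^bsub>A\<^esub> \<one>\<^bsub>A\<^esub>)) W"

section \<open>Growth\<close>

primrec subspace_power :: "('k::field, 'a, 'm) module_scheme \<Rightarrow> 'a set \<Rightarrow> nat \<Rightarrow> 'a set" where
  "subspace_power A V 0 = lin_span A {\<one>\<^bsub>A\<^esub>}"
| "subspace_power A V (Suc n) = lin_span A (V <#>\<^bsub>A\<^esub> subspace_power A V n)"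

definition exponential_growth :: "('k::field, 'a, 'm) module_scheme \<Rightarrow> bool" where
  "exponential_growth A \<longleftrightarrow>
     (\<exists>V. subspace_of V A \<and> (\<exists>m. has_dim A V m) \<and> \<one>\<^bsub>A\<^esub> \<in> V \<and> alg_generated A V = carrier A \<and>
        (\<exists>\<beta>::real. \<beta> > 1 \<and>
           (\<exists>N. \<forall>n\<ge>N. \<exists>m. has_dim A (subspace_power A V n) m \<and> real m \<ge> \<beta> ^ n)))"

section \<open>Free algebras and monomial algebras\<close>

text \<open>
  Words form a monoid under concatenation, written additively because the convolution product
  of \<^typ>\<open>'w \<Rightarrow>\<^sub>0 'k\<close> is defined for \<^class>\<open>monoid_add\<close>.
\<close>

instantiation list :: (type) monoid_add
begin

definition zero_list :: "'a list" where "0 = []"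

definition plus_list :: "'a list \<Rightarrow> 'a list \<Rightarrow> 'a list" where "xs + ys = xs @ ys"

instance by standard (auto simp: zero_list_def plus_list_def)

end

definition word_monom :: "'x list \<Rightarrow> ('x list \<Rightarrow>\<^sub>0 'k::field)" where
  "word_monom w = Poly_Mapping.single w 1"

definition free_algebra :: "'x set \<Rightarrow> ('k::field, 'x list \<Rightarrow>\<^sub>0 'k) module" where
  "free_algebra L =
     \<lparr>carrier = {p. Poly_Mapping.keys p \<subseteq> lists L},
      monoid.mult = (*), one = 1, ring.zero = 0, add = (+),
      module.smult = (\<lambda>c p. Poly_Mapping.single [] c * p)\<rparr>"

definition quot_algebra ::
  "('k::field, 'a, 'm) module_scheme \<Rightarrow> 'a set \<Rightarrow> ('k, 'a set) module" where
  "quot_algebra A I =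
     ring.extend (A Quot I) (module.fields (\<lambda>c C. \<Union>a \<in> C. I +>\<^bsub>A\<^esub> (c \<odot>\<^bsub>A\<^esub> a)))"

definition monomial_quotient :: "'x set \<Rightarrow> 'x list set \<Rightarrow> ('k::field, ('x list \<Rightarrow>\<^sub>0 'k) set) module"
  where
  "monomial_quotient L M =
     quot_algebra (free_algebra L) (Idl\<^bsub>free_algebra L :: ('k, _) module\<^esub> (word_monom ` M))"

definition monomial_algebra :: "('k::field, 'a, 'm) module_scheme \<Rightarrow> bool" where
  "monomial_algebra A \<longleftrightarrow>
     (\<exists>(d::nat) M. M \<subseteq> lists {1..d} \<and>
        alg_iso (monomial_quotient {1..d} M :: ('k, (nat list \<Rightarrow>\<^sub>0 'k) set) module) A \<noteq> {})"

text \<open>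
  The free generating set \<open>Y\<close> may be taken inside the type of \<open>A\<close>, since a set freely generating
  a subalgebra of \<open>A\<close> embeds into \<open>A\<close>.
\<close>

definition noncomm_free_subalgebra :: "'a set \<Rightarrow> ('k::field, 'a, 'm) module_scheme \<Rightarrow> bool" where
  "noncomm_free_subalgebra B A \<longleftrightarrow>
     subalgebra_of B A \<and>
     (\<exists>Y :: 'a set. (\<exists>y\<in>Y. \<exists>z\<in>Y. y \<noteq> z) \<and>
        alg_iso (free_algebra Y :: ('k, 'a list \<Rightarrow>\<^sub>0 'k) module) (A\<lparr>carrier := B\<rparr>) \<noteq> {})"

text \<open>
  Infinite words \<open>\<epsilon>\<^sub>1 \<epsilon>\<^sub>2 \<epsilon>\<^sub>3 \<dots>\<close> are indexed from 1; the value at 0 is irrelevant.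
\<close>

definition factor_of :: "'x list \<Rightarrow> (nat \<Rightarrow> 'x) \<Rightarrow> bool" where
  "factor_of w \<epsilon> \<longleftrightarrow> (\<exists>p\<ge>1. w = map \<epsilon> [p..<p + length w])"

end

theory Submission
  imports Defs
begin

text \<open>
  The quotient \<open>A\<close> has the words that are factors of admissible infinite words as a basis. Both
  claims reflect a property of the set \<open>S\<close> of positions at which the letter \<open>x\<^sub>1\<close> is forced.

  Growth: \<open>S\<close> has density at most \<open>1/10 + 1/100 + \<dots> = 1/9\<close>, so the prefix of length \<open>n\<close> leaves
  at least half of its positions free to carry \<open>x\<^sub>2\<close> or \<open>x\<^sub>3\<close> independently. This gives at least
  \<open>2 ^ (n / 2)\<close> basis words of length \<open>n\<close>
  (\<open>card_one_positions_upto\<close>, \<open>allowed_growth\<close>).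

  Free subalgebras: each positive multiple of \<open>10\<^sup>k\<close> starts a run of \<open>k\<close> consecutive elements of \<open>S\<close>
  (\<open>one_positions_run\<close>), so every long enough basis word contains \<open>x\<^sub>1\<^sup>k\<close>. On the other hand, a
  product of words of length at most \<open>d\<close> with \<open>d \<ge> 1\<close>, none of them a power of \<open>x\<^sub>1\<close>, never contains
  \<open>x\<^sub>1\<close> to the power \<open>2d\<close>; hence such products vanish once they have many factors
  (\<open>nil_words\<close>). In other words, the ideal \<open>J\<close> generated by \<open>x\<^sub>2\<close> and \<open>x\<^sub>3\<close> is locally
  nilpotent. Since \<open>A/J\<close> is generated by \<open>x\<^sub>1\<close> and therefore commutative, every commutator lies
  in \<open>J\<close> and is nilpotent. If \<open>y\<close> and \<open>z\<close> were free generators, all powers of \<open>yz - zy\<close> would be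
  nonzero, because \<open>(yz)\<^sup>n\<close> occurs in them with coefficient 1 (\<open>no_free_subalgebra\<close>).
\<close>

section \<open>Elements of the free algebra supported on a set of words\<close>

text \<open>
  The linear span of a set of words. The ideal defining a monomial algebra is of this form, and the
  powers of the generating subspace are images of such spans, so membership in all of them can be
  decided by looking at words.
\<close>

definition supported :: "'w set \<Rightarrow> ('w \<Rightarrow>\<^sub>0 'k::zero) set" where
  "supported F = {p. Poly_Mapping.keys p \<subseteq> F}"

lemma supportedI: "(\<And>w. Poly_Mapping.lookup p w \<noteq> 0 \<Longrightarrow> w \<in> F) \<Longrightarrow> p \<in> supported F"
  by (auto simp: supported_def in_keys_iff)

lemma supportedD: "p \<in> supported F \<Longrightarrow> Poly_Mapping.lookup p w \<noteq> 0 \<Longrightarrow> w \<in> F"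
  by (auto simp: supported_def in_keys_iff)

lemma supported_0 [simp]: "0 \<in> supported F"
  by (simp add: supported_def)

lemma supported_add [simp, intro]: "p \<in> supported F \<Longrightarrow> q \<in> supported F \<Longrightarrow> p + q \<in> supported F"
  using Poly_Mapping.keys_add[of p q] by (auto simp: supported_def)

lemma supported_uminus [simp]:
  "- p \<in> supported F \<longleftrightarrow> p \<in> supported F" for p :: "_ \<Rightarrow>\<^sub>0 'k::ab_group_add"
  by (auto simp: supported_def in_keys_iff subset_eq)

lemma supported_diff [simp, intro]:
  "p \<in> supported F \<Longrightarrow> q \<in> supported F \<Longrightarrow> p - q \<in> supported F" for p :: "_ \<Rightarrow>\<^sub>0 'k::ab_group_add"
  using supported_add[of p F "- q"] by simp

lemma supported_mult:
  fixes p :: "'x list \<Rightarrow>\<^sub>0 'k::semiring_0"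
  assumes "p \<in> supported F" "q \<in> supported G"
    and "\<And>u v. u \<in> F \<Longrightarrow> v \<in> G \<Longrightarrow> u @ v \<in> H"
  shows "p * q \<in> supported H"
  using keys_mult[of p q] assms by (fastforce simp: supported_def plus_list_def)

lemma supported_single: "w \<in> F \<Longrightarrow> Poly_Mapping.single w c \<in> supported F"
  by (simp add: supported_def)

lemma supported_mono: "p \<in> supported F \<Longrightarrow> F \<subseteq> G \<Longrightarrow> p \<in> supported G"
  by (auto simp: supported_def)

lemma supported_empty [simp]: "supported {} = {0}"
  by (auto simp: supported_def)

lemma sum_of_monomials:
  "p = (\<Sum>w\<in>Poly_Mapping.keys p. Poly_Mapping.single w (Poly_Mapping.lookup p w))"
  by (rule poly_mapping_eqI) (auto simp: lookup_sum lookup_single when_def in_keys_iff)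

text \<open>
  This is extension by linearity: a property that is additive and holds for scaled words holds
  for all elements supported on these words.
\<close>

lemma supported_induct [consumes 1, case_names zero add single]:
  fixes p :: "'w \<Rightarrow>\<^sub>0 'k::comm_monoid_add"
  assumes "p \<in> supported F"
    and "P 0" and "\<And>p q. P p \<Longrightarrow> P q \<Longrightarrow> P (p + q)"
    and "\<And>w c. w \<in> F \<Longrightarrow> P (Poly_Mapping.single w c)"
  shows "P p"
proof -
  have "P (\<Sum>w\<in>W. Poly_Mapping.single w (Poly_Mapping.lookup p w))" if "finite W" "W \<subseteq> F" for W
    using that by induction (use assms(2-4) in auto)
  from this[of "Poly_Mapping.keys p"] show ?thesis
    using assms(1) by (simp add: supported_def flip: sum_of_monomials)
qed

lemma mult_single_words:
  "Poly_Mapping.single u c * Poly_Mapping.single v d = Poly_Mapping.single (u @ v) (c * d)"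
  by (simp add: mult_single plus_list_def)

lemma free_algebra_simps [simp]:
  "carrier (free_algebra L) = supported (lists L)"
  "p \<otimes>\<^bsub>free_algebra L\<^esub> q = p * q"
  "p \<oplus>\<^bsub>free_algebra L\<^esub> q = p + q"
  "\<one>\<^bsub>free_algebra L\<^esub> = 1"
  "\<zero>\<^bsub>free_algebra L\<^esub> = 0"
  "c \<odot>\<^bsub>free_algebra L\<^esub> p = Poly_Mapping.single [] c * p"
  by (simp_all add: free_algebra_def supported_def)

lemma one_supported: "[] \<in> F \<Longrightarrow> (1 :: 'x list \<Rightarrow>\<^sub>0 'k::zero_neq_one) \<in> supported F"
  by (simp add: supported_def zero_list_def)

lemma supported_mult_lists [simp, intro]:
  fixes p :: "'x list \<Rightarrow>\<^sub>0 'k::semiring_0"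
  shows "p \<in> supported (lists L) \<Longrightarrow> q \<in> supported (lists L) \<Longrightarrow> p * q \<in> supported (lists L)"
  by (erule supported_mult) auto

lemma ring_free_algebra: "ring (free_algebra L :: ('k::field, _) module)"
proof (rule ringI)
  show "abelian_group (free_algebra L :: ('k, _) module)"
  proof (rule abelian_groupI)
    fix p :: "'a list \<Rightarrow>\<^sub>0 'k" assume "p \<in> carrier (free_algebra L)"
    then show "\<exists>q\<in>carrier (free_algebra L). q \<oplus>\<^bsub>free_algebra L\<^esub> p = \<zero>\<^bsub>free_algebra L\<^esub>"
      by (intro bexI[of _ "- p"]) auto
  qed (auto simp: algebra_simps)
  show "Group.monoid (free_algebra L :: ('k, _) module)"
    by (rule monoidI) (auto simp: one_supported algebra_simps)
qed (auto simp: algebra_simps)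

lemma supported_word: "w \<in> F \<Longrightarrow> word_monom w \<in> supported F"
  by (simp add: word_monom_def supported_single)

lemma mult_word_monom: "word_monom u * word_monom v = (word_monom (u @ v) :: _ \<Rightarrow>\<^sub>0 'k::field)"
  by (simp add: word_monom_def mult_single_words)

lemma word_monom_Nil: "word_monom [] = (1 :: _ \<Rightarrow>\<^sub>0 'k::field)"
  by (simp add: word_monom_def flip: zero_list_def)

section \<open>Quotients by an extension-closed set of words\<close>

text \<open>
  If \<open>M\<close> is already closed under multiplication by words on both sides, then the span of
  \<open>M\<close> is itself an ideal. Sets of forbidden words are of this kind, because an extension
  of a word that is not a factor is not a factor either.
\<close>

locale extension_closed =
  fixes L :: "'x set" and M :: "'x list set"
  assumes M_words: "M \<subseteq> lists L"
    and M_extend: "w \<in> M \<Longrightarrow> u \<in> lists L \<Longrightarrow> v \<in> lists L \<Longrightarrow> u @ w @ v \<in> M"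
begin

lemma supported_M_lists: "p \<in> supported M \<Longrightarrow> p \<in> supported (lists L)"
  using M_words supported_mono by blast

lemma supported_M_mult:
  fixes p q :: "'x list \<Rightarrow>\<^sub>0 'k::semiring_0"
  shows "p \<in> supported M \<Longrightarrow> q \<in> supported (lists L) \<Longrightarrow> p * q \<in> supported M"
    and "p \<in> supported M \<Longrightarrow> q \<in> supported (lists L) \<Longrightarrow> q * p \<in> supported M"
  using M_extend[of _ "[]"] M_extend[of _ _ "[]"] by (auto elim!: supported_mult)

lemma ideal_supported: "ideal (supported M) (free_algebra L :: ('k::field, _) module)"
proof (rule idealI[OF ring_free_algebra])
  interpret ring "free_algebra L :: ('k, _) module" by (rule ring_free_algebra)
  show "subgroup (supported M) (add_monoid (free_algebra L :: ('k, _) module))"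
  proof (rule add.subgroupI)
    fix p :: "'x list \<Rightarrow>\<^sub>0 'k" assume p: "p \<in> supported M"
    then have "\<ominus>\<^bsub>free_algebra L\<^esub> p = - p"
      using supported_M_lists by (intro minus_equality) auto
    then show "\<ominus>\<^bsub>free_algebra L\<^esub> p \<in> supported M" using p by simp
  next
    show "supported M \<noteq> ({} :: ('x list \<Rightarrow>\<^sub>0 'k) set)" using supported_0 by blast
  qed (auto intro: supported_M_lists)
qed (auto intro: supported_M_mult)

lemma Idl_monomials:
  "Idl\<^bsub>free_algebra L :: ('k::field, _) module\<^esub> (word_monom ` M) = supported M"
proof
  interpret ring "free_algebra L :: ('k, _) module" by (rule ring_free_algebra)
  let ?I = "Idl\<^bsub>free_algebra L :: ('k, _) module\<^esub> (word_monom ` M)"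
  have words: "word_monom ` M \<subseteq> carrier (free_algebra L :: ('k, _) module)"
    using M_words by (auto simp: word_monom_def supported_def)
  show "?I \<subseteq> supported M"
    by (rule genideal_minimal[OF ideal_supported]) (auto simp: word_monom_def supported_def)
  interpret I: ideal ?I "free_algebra L :: ('k, _) module"
    by (rule genideal_ideal[OF words])
  show "supported M \<subseteq> ?I"
  proof
    fix p :: "'x list \<Rightarrow>\<^sub>0 'k" assume "p \<in> supported M"
    then show "p \<in> ?I"
    proof (induction rule: supported_induct)
      case zero
      show ?case using I.zero_closed by simp
    next
      case (add p q)
      then show ?case using I.a_closed[of p q] by simp
    next
      case (single w c)
      have "Poly_Mapping.single [] c \<otimes>\<^bsub>free_algebra L\<^esub> (word_monom w :: _ \<Rightarrow>\<^sub>0 'k) \<in> ?I"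
        using single genideal_self[OF words] by (intro I.I_l_closed) (auto intro: supported_single)
      then show ?case by (simp add: word_monom_def mult_single_words)
    qed
  qed
qed

text \<open>
  The residue class of \<open>p\<close>, written as an explicit set so that equality of classes becomes a
  statement about the words occurring in a difference.
\<close>

definition cls :: "('x list \<Rightarrow>\<^sub>0 'k::field) \<Rightarrow> ('x list \<Rightarrow>\<^sub>0 'k) set" where
  "cls p = {q. q - p \<in> supported M}"

lemma cls_eq_iff: "cls p = cls q \<longleftrightarrow> p - q \<in> supported M"
proof
  assume "cls p = cls q"
  moreover have "p \<in> cls p" by (simp add: cls_def)
  ultimately have "p \<in> cls q" by (rule subst)
  then show "p - q \<in> supported M" by (simp add: cls_def)
next
  assume pq: "p - q \<in> supported M"
  have "r - q \<in> supported M" if "r - p \<in> supported M" for r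
    using supported_add[OF that pq] by simp
  moreover have "r - p \<in> supported M" if "r - q \<in> supported M" for r
    using supported_diff[OF that pq] by simp
  ultimately show "cls p = cls q" unfolding cls_def by (intro Collect_cong iffI)
qed

lemma coset_eq_cls: "supported M +>\<^bsub>free_algebra L :: ('k::field, _) module\<^esub> p = cls p"
proof -
  have "supported M +>\<^bsub>free_algebra L :: ('k, _) module\<^esub> p = (\<lambda>h. h + p) ` supported M"
    by (auto simp: a_r_coset_def')
  also have "\<dots> = cls p"
    by (auto simp: cls_def image_iff) (metis diff_add_cancel)
  finally show ?thesis .
qed

definition Q :: "('k::field, ('x list \<Rightarrow>\<^sub>0 'k) set) module" where
  "Q = quot_algebra (free_algebra L) (supported M)"

lemma Q_eq: "Q = monomial_quotient L M"
  by (simp add: Q_def monomial_quotient_def Idl_monomials)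

lemma Q_fields:
  "carrier Q = carrier (free_algebra L Quot (supported M))"
  "monoid.mult Q = monoid.mult (free_algebra L Quot (supported M))"
  "one Q = one (free_algebra L Quot (supported M))"
  "ring.zero Q = ring.zero (free_algebra L Quot (supported M))"
  "add Q = add (free_algebra L Quot (supported M))"
  by (simp_all add: Q_def quot_algebra_def ring.defs module.defs)

lemma carrier_Q: "carrier Q = cls ` supported (lists L)"
  by (auto simp: Q_fields FactRing_def A_RCOSETS_def' coset_eq_cls)

lemma zero_Q: "\<zero>\<^bsub>Q\<^esub> = cls 0"
  by (simp add: Q_fields FactRing_def cls_def)

lemma one_Q: "\<one>\<^bsub>Q\<^esub> = cls 1"
  by (simp add: Q_fields FactRing_def coset_eq_cls)

context
  fixes p q :: "'x list \<Rightarrow>\<^sub>0 'k::field"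
  assumes p: "p \<in> supported (lists L)" and q: "q \<in> supported (lists L)"
begin

lemma mult_Q: "cls p \<otimes>\<^bsub>Q\<^esub> cls q = cls (p * q)"
proof -
  interpret ideal "supported M" "free_algebra L :: ('k, _) module" by (rule ideal_supported)
  show ?thesis
    using rcoset_mult_add p q by (simp add: Q_fields FactRing_def coset_eq_cls)
qed

lemma add_Q: "cls p \<oplus>\<^bsub>Q\<^esub> cls q = cls (p + q)"
proof -
  interpret ideal "supported M" "free_algebra L :: ('k, _) module" by (rule ideal_supported)
  show ?thesis
    using a_rcos_sum p q by (simp add: Q_fields FactRing_def coset_eq_cls)
qed

end

lemma smult_Q:
  assumes "p \<in> supported (lists L)"
  shows "c \<odot>\<^bsub>Q\<^esub> cls p = cls (Poly_Mapping.single [] c * p)"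
proof -
  have "(\<Union>q\<in>cls p. cls (Poly_Mapping.single [] c * q)) = cls (Poly_Mapping.single [] c * p)"
  proof (rule SUP_eq_const)
    show "cls p \<noteq> {}" by (auto simp: cls_def intro: exI[of _ p])
    fix q assume "q \<in> cls p"
    then have "Poly_Mapping.single [] c * (q - p) \<in> supported M"
      by (intro supported_M_mult) (auto simp: cls_def supported_single)
    then show "cls (Poly_Mapping.single [] c * q) = cls (Poly_Mapping.single [] c * p)"
      by (simp add: cls_eq_iff right_diff_distrib)
  qed
  then show ?thesis
    by (simp add: Q_def quot_algebra_def ring.defs module.defs coset_eq_cls)
qed

end

lemma subspace_ofD:
  assumes "subspace_of W (B :: ('k::field, 'a, 'm) module_scheme)"
  shows "\<zero>\<^bsub>B\<^esub> \<in> W" "\<And>x y. x \<in> W \<Longrightarrow> y \<in> W \<Longrightarrow> x \<oplus>\<^bsub>B\<^esub> y \<in> W" "\<And>c x. x \<in> W \<Longrightarrow> c \<odot>\<^bsub>B\<^esub> x \<in> W"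
proof -
  interpret submodule W "ring_of_type_algebra :: 'k ring" B
    using assms by (simp add: subspace_of_def)
  show "\<zero>\<^bsub>B\<^esub> \<in> W" using one_closed by simp
  show "x \<oplus>\<^bsub>B\<^esub> y \<in> W" if "x \<in> W" "y \<in> W" for x y using m_closed[OF that] by simp
  show "c \<odot>\<^bsub>B\<^esub> x \<in> W" if "x \<in> W" for c x
    using that by (simp add: ring_of_type_algebra_def)
qed

context extension_closed
begin

lemma ring_Q: "ring (Q :: ('k::field, _) module)"
proof (rule ringI)
  show "abelian_group (Q :: ('k, _) module)"
  proof (rule abelian_groupI)
    fix x :: "('x list \<Rightarrow>\<^sub>0 'k) set" assume "x \<in> carrier Q"
    then obtain p where "x = cls p" "p \<in> supported (lists L)" by (auto simp: carrier_Q)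
    then show "\<exists>y\<in>carrier Q. y \<oplus>\<^bsub>Q\<^esub> x = \<zero>\<^bsub>Q\<^esub>"
      by (intro bexI[of _ "cls (- p)"]) (auto simp: carrier_Q add_Q zero_Q)
  qed (auto simp: carrier_Q add_Q zero_Q ac_simps)
  show "Group.monoid (Q :: ('k, _) module)"
    by (rule monoidI)
      (auto simp: carrier_Q mult_Q one_Q one_supported supported_mult_lists algebra_simps)
qed (auto simp: carrier_Q mult_Q add_Q supported_mult_lists supported_add algebra_simps)

lemma uminus_Q:
  fixes p :: "'x list \<Rightarrow>\<^sub>0 'k::field"
  assumes "p \<in> supported (lists L)"
  shows "\<ominus>\<^bsub>Q\<^esub> cls p = cls (- p)"
proof -
  interpret ring "Q :: ('k, _) module" by (rule ring_Q)
  show ?thesis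
    using assms by (intro minus_equality) (auto simp: carrier_Q add_Q zero_Q)
qed

end

section \<open>Growth of the quotient\<close>

context extension_closed
begin

lemma subspace_cls:
  assumes "F \<subseteq> lists L"
  shows "subspace_of (cls ` supported F) (Q :: ('k::field, _) module)"
proof -
  interpret ring "Q :: ('k, _) module" by (rule ring_Q)
  have F: "p \<in> supported (lists L)" if "p \<in> supported F" for p :: "'x list \<Rightarrow>\<^sub>0 'k"
    using that assms by (rule supported_mono)
  show ?thesis
    unfolding subspace_of_def
  proof (rule submodule.intro)
    show "subgroup (cls ` supported F) (add_monoid (Q :: ('k, _) module))"
    proof (rule add.subgroupI)
      show "cls ` supported F \<noteq> ({} :: ('x list \<Rightarrow>\<^sub>0 'k) set set)" using supported_0 by blast
    qed (auto simp: carrier_Q F uminus_Q add_Q)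
    have "Poly_Mapping.single [] c * p \<in> supported F"
      if "p \<in> supported F" for c and p :: "'x list \<Rightarrow>\<^sub>0 'k"
      using supported_mult[OF supported_single[of "[]" "{[]}" c] that] by simp
    then show "submodule_axioms (cls ` supported F) ring_of_type_algebra (Q :: ('k, _) module)"
      by (auto simp: submodule_axioms_def F smult_Q)
  qed
qed

text \<open>
  The hypotheses on \<open>W\<close> are those shared by subspaces and subalgebras, so that both spans and
  generated subalgebras can be bounded from below by words alone.
\<close>

lemma cls_in_subspace:
  fixes p :: "'x list \<Rightarrow>\<^sub>0 'k::field" and W :: "('x list \<Rightarrow>\<^sub>0 'k) set set"
  assumes W0: "\<zero>\<^bsub>Q\<^esub> \<in> W"
    and W_add: "\<And>x y. x \<in> W \<Longrightarrow> y \<in> W \<Longrightarrow> x \<oplus>\<^bsub>Q\<^esub> y \<in> W"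
    and W_smult: "\<And>c x. x \<in> W \<Longrightarrow> c \<odot>\<^bsub>Q\<^esub> x \<in> W"
    and words: "\<And>w. w \<in> F \<Longrightarrow> cls (word_monom w) \<in> W"
    and F: "F \<subseteq> lists L" and p: "p \<in> supported F"
  shows "cls p \<in> W"
proof -
  from p have "p \<in> supported (lists L) \<and> cls p \<in> W"
  proof (induction rule: supported_induct)
    case zero
    then show ?case using W0 by (simp add: zero_Q)
  next
    case (add p q)
    then show ?case using W_add[of "cls p" "cls q"] by (auto simp: add_Q)
  next
    case (single w c)
    have w: "w \<in> lists L" using single F by blast
    show ?case
      using smult_Q[of "word_monom w" c] W_smult[OF words[OF single], of c]
      by (simp add: word_monom_def supported_single[OF w] mult_single_words)
  qed
  then show ?thesis ..
qed

lemma lin_span_eq_cls: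
  fixes T :: "('x list \<Rightarrow>\<^sub>0 'k::field) set set"
  assumes "F \<subseteq> lists L" "T \<subseteq> cls ` supported F"
    and "\<And>w. w \<in> F \<Longrightarrow> cls (word_monom w) \<in> T"
  shows "lin_span Q T = cls ` supported F"
proof
  show "lin_span Q T \<subseteq> cls ` supported F"
    unfolding lin_span_def using assms(2) subspace_cls[OF assms(1)] by blast
  show "cls ` supported F \<subseteq> lin_span Q T"
    unfolding lin_span_def
  proof (intro subsetI InterI; elim imageE)
    fix W :: "('x list \<Rightarrow>\<^sub>0 'k) set set" and x :: "('x list \<Rightarrow>\<^sub>0 'k) set" and p
    assume "W \<in> {W. subspace_of W Q \<and> T \<subseteq> W}" and x: "x = cls p" "p \<in> supported F"
    then have W: "subspace_of W Q" and words: "\<And>w. w \<in> F \<Longrightarrow> cls (word_monom w) \<in> W"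
      using assms(3) by auto
    show "x \<in> W"
      unfolding x(1) by (rule cls_in_subspace[OF subspace_ofD[OF W] words assms(1) x(2)])
  qed
qed

abbreviation words_upto :: "nat \<Rightarrow> 'x list set" where
  "words_upto n \<equiv> {w \<in> lists L. length w \<le> n}"

lemma words_upto_lists: "p \<in> supported (words_upto n) \<Longrightarrow> p \<in> supported (lists L)"
  by (erule supported_mono) auto

text \<open>
  With \<open>V\<close> spanned by the empty word and the letters, \<open>V\<^sup>n\<close> is spanned by the words of length
  at most \<open>n\<close>: the unit in \<open>V\<close> is what makes the shorter words available.
\<close>

lemma subspace_power_eq:
  "subspace_power (Q :: ('k::field, _) module) (cls ` supported (words_upto 1)) n
     = cls ` supported (words_upto n)"
proof (induction n)
  case 0
  show ?case unfolding subspace_power.simps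
    by (rule lin_span_eq_cls) (auto simp: one_Q one_supported word_monom_Nil)
next
  case (Suc n)
  show ?case unfolding subspace_power.simps Suc
  proof (rule lin_span_eq_cls)
    show "cls ` supported (words_upto 1) <#>\<^bsub>Q\<^esub> cls ` supported (words_upto n)
      \<subseteq> (cls ` supported (words_upto (Suc n)) :: ('x list \<Rightarrow>\<^sub>0 'k) set set)"
    proof (clarsimp simp: set_mult_def)
      fix p q :: "'x list \<Rightarrow>\<^sub>0 'k"
      assume pq: "p \<in> supported (words_upto (Suc 0))" "q \<in> supported (words_upto n)"
      then have "p * q \<in> supported (words_upto (Suc n))" by (rule supported_mult) auto
      then show "cls p \<otimes>\<^bsub>Q\<^esub> cls q \<in> cls ` supported (words_upto (Suc n))"
        using pq by (simp add: mult_Q words_upto_lists)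
    qed
    fix w assume w: "w \<in> words_upto (Suc n)"
    \<comment> \<open>the empty word is the product of two empty words\<close>
    obtain u v where uv: "w = u @ v" "u \<in> words_upto 1" "v \<in> words_upto n"
    proof (cases w)
      case Nil
      with that[of "[]" "[]"] show ?thesis by simp
    next
      case (Cons a v)
      with that[of "[a]" v] w show ?thesis by simp
    qed
    then have "cls (word_monom w) = cls (word_monom u) \<otimes>\<^bsub>Q\<^esub> (cls (word_monom v) :: ('x list \<Rightarrow>\<^sub>0 'k) set)"
      by (simp add: mult_Q supported_word mult_word_monom)
    moreover have "cls (word_monom u) \<in> (cls ` supported (words_upto 1) :: ('x list \<Rightarrow>\<^sub>0 'k) set set)"
      "cls (word_monom v) \<in> (cls ` supported (words_upto n) :: ('x list \<Rightarrow>\<^sub>0 'k) set set)"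
      by (intro imageI supported_word uv)+
    ultimately show "cls (word_monom w) \<in> cls ` supported (words_upto 1) <#>\<^bsub>Q\<^esub>
        (cls ` supported (words_upto n) :: ('x list \<Rightarrow>\<^sub>0 'k) set set)"
      unfolding set_mult_def by blast
  qed auto
qed

lemma generated_by_letters:
  "alg_generated (Q :: ('k::field, _) module) (cls ` supported (words_upto 1)) = carrier Q"
proof
  interpret ring "Q :: ('k, _) module" by (rule ring_Q)
  have "subalgebra_of (carrier Q) (Q :: ('k, _) module)"
    unfolding subalgebra_of_def using carrier_is_subring
    by (auto simp: carrier_Q smult_Q supported_mult_lists supported_single)
  then show "alg_generated Q (cls ` supported (words_upto 1)) \<subseteq> carrier (Q :: ('k, _) module)"
    unfolding alg_generated_def by (auto simp: carrier_Q dest: words_upto_lists)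
  show "carrier (Q :: ('k, _) module) \<subseteq> alg_generated Q (cls ` supported (words_upto 1))"
    unfolding alg_generated_def
  proof (intro subsetI InterI)
    fix B :: "('x list \<Rightarrow>\<^sub>0 'k) set set" and x :: "('x list \<Rightarrow>\<^sub>0 'k) set"
    assume "B \<in> {B. subalgebra_of B Q \<and> cls ` supported (words_upto 1) \<subseteq> B}" and x: "x \<in> carrier Q"
    then have sub: "subring B Q" and smult: "\<And>c x. x \<in> B \<Longrightarrow> c \<odot>\<^bsub>Q\<^esub> x \<in> B"
      and letters: "cls ` supported (words_upto 1) \<subseteq> B"
      by (auto simp: subalgebra_of_def)
    have words: "cls (word_monom w) \<in> B" if "w \<in> lists L" for w
      using that
    proof (induction w)
      case Nil
      then show ?case using subringE(3)[OF sub] by (simp add: one_Q word_monom_Nil)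
    next
      case (Cons a w)
      have a: "cls (word_monom [a]) \<in> B"
        using letters Cons.hyps supported_word[of "[a]" "words_upto 1"] by auto
      have "cls (word_monom [a]) \<otimes>\<^bsub>Q\<^esub> cls (word_monom w) = (cls (word_monom (a # w)) :: ('x list \<Rightarrow>\<^sub>0 'k) set)"
        using Cons.hyps by (subst mult_Q) (auto simp: supported_word mult_word_monom)
      then show ?case using subringE(6)[OF sub a Cons.IH] by simp
    qed
    from x obtain p where p: "x = cls p" "p \<in> supported (lists L)" by (auto simp: carrier_Q)
    show "x \<in> B"
      unfolding p(1)
      by (rule cls_in_subspace[OF subringE(2)[OF sub] subringE(7)[OF sub] smult words order_refl p(2)])
  qed
qed

text \<open>
  Words outside \<open>M\<close> are linearly independent modulo the span of \<open>M\<close>, since a combination of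
  them that lies in the ideal has no word left. The dimension grows by one with each added word:
  the coefficient of the new word is 1 in its difference with any combination of the others.
\<close>

lemma has_dim_cls:
  assumes "finite F" "F \<subseteq> lists L" "F \<inter> M = {}"
  shows "has_dim (Q :: ('k::field, _) module) (cls ` supported F) (card F)"
  using assms
proof (induction F)
  case empty
  interpret ring "Q :: ('k, _) module" by (rule ring_Q)
  show ?case
    unfolding has_dim_def supported_empty image_insert image_empty card.empty zero_Q[symmetric]
    by (rule zero_dim)
next
  case (insert w F)
  interpret ring "Q :: ('k, _) module" by (rule ring_Q)
  define K where "K = range (\<lambda>c. c \<odot>\<^bsub>Q\<^esub> \<one>\<^bsub>Q :: ('k, _) module\<^esub>)"
  define E where "E = (cls ` supported F :: ('x list \<Rightarrow>\<^sub>0 'k) set set)"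
  have K: "K = (\<lambda>c. cls (Poly_Mapping.single [] c)) ` UNIV"
  proof -
    have "c \<odot>\<^bsub>Q\<^esub> \<one>\<^bsub>Q\<^esub> = cls (Poly_Mapping.single [] c)" for c :: 'k
      using smult_Q[of 1 c] by (simp add: one_Q one_supported)
    then show ?thesis by (simp only: K_def)
  qed
  have F: "p \<in> supported (lists L)" if "p \<in> supported F" for p :: "'x list \<Rightarrow>\<^sub>0 'k"
    by (rule supported_mono[OF that]) (use insert.prems in blast)
  have v: "cls (word_monom w) \<in> carrier (Q :: ('k, _) module)"
    using insert.prems by (auto simp: carrier_Q supported_word)
  have "cls (word_monom w) \<notin> E"
  proof
    assume "cls (word_monom w) \<in> E"
    then obtain q :: "'x list \<Rightarrow>\<^sub>0 'k" where q: "q \<in> supported F" "word_monom w - q \<in> supported M"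
      by (auto simp: E_def cls_eq_iff)
    have "Poly_Mapping.lookup (word_monom w - q) w = 1"
      using q(1) insert.hyps by (auto simp: lookup_minus word_monom_def supported_def in_keys_iff)
    then have "w \<in> Poly_Mapping.keys (word_monom w - q)" by (simp add: in_keys_iff)
    then show False using q(2) insert.prems by (auto simp: supported_def)
  qed
  moreover have "dimension (card F) K E"
    using insert.IH insert.prems by (simp add: has_dim_def K_def E_def)
  ultimately have "dimension (Suc (card F)) K (line_extension K (cls (word_monom w)) E)"
    by (rule Suc_dim[OF v])
  moreover have "line_extension K (cls (word_monom w)) E = cls ` supported (insert w F)"
  proof -
    have step: "cls (Poly_Mapping.single [] c) \<otimes>\<^bsub>Q\<^esub> cls (word_monom w) \<oplus>\<^bsub>Q\<^esub> cls q
        = cls (Poly_Mapping.single w c + q)" if "q \<in> supported F" for c and q :: "'x list \<Rightarrow>\<^sub>0 'k"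
      using that insert.prems
      by (simp add: mult_Q add_Q F supported_single word_monom_def mult_single_words)
    show ?thesis
    proof (intro equalityI subsetI)
      fix x assume "x \<in> line_extension K (cls (word_monom w)) E"
      then obtain c q where q: "q \<in> supported F"
        and "x = cls (Poly_Mapping.single [] c) \<otimes>\<^bsub>Q\<^esub> cls (word_monom w) \<oplus>\<^bsub>Q\<^esub> cls q"
        unfolding line_extension_mem_iff K E_def by blast
      then have "x = cls (Poly_Mapping.single w c + q)" by (simp only: step)
      moreover have "Poly_Mapping.single w c + q \<in> supported (insert w F)"
        using supported_mono[OF q, of "insert w F"] by (intro supported_add supported_single) auto
      ultimately show "x \<in> cls ` supported (insert w F)" by blast
    next
      fix x :: "('x list \<Rightarrow>\<^sub>0 'k) set" assume "x \<in> cls ` supported (insert w F)"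
      then obtain p where p: "x = cls p" "p \<in> supported (insert w F)" by blast
      define c where "c = Poly_Mapping.lookup p w"
      have q: "p - Poly_Mapping.single w c \<in> supported F"
        using supportedD[OF p(2)]
        by (intro supportedI) (auto simp: c_def lookup_minus lookup_single when_def split: if_splits)
      have "x = cls (Poly_Mapping.single [] c) \<otimes>\<^bsub>Q\<^esub> cls (word_monom w) \<oplus>\<^bsub>Q\<^esub> cls (p - Poly_Mapping.single w c)"
        unfolding step[OF q] p(1) by simp
      then show "x \<in> line_extension K (cls (word_monom w)) E"
        unfolding line_extension_mem_iff K E_def using q by blast
    qed
  qed
  ultimately show ?case using insert.hyps by (simp add: has_dim_def K_def)
qed

text \<open>
  A representative may drop its forbidden words without changing its class.
\<close>

lemma cls_supported_diff:
  "cls ` supported (F - M) = (cls ` supported F :: ('x list \<Rightarrow>\<^sub>0 'k::field) set set)"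
proof (intro equalityI subsetI)
  fix x :: "('x list \<Rightarrow>\<^sub>0 'k) set" assume "x \<in> cls ` supported F"
  then obtain p where p: "x = cls p" "p \<in> supported F" by auto
  define q where "q = Poly_Mapping.mapp (\<lambda>w c. c when w \<notin> M) p"
  have q: "Poly_Mapping.lookup q w = (Poly_Mapping.lookup p w when w \<notin> M)" for w
    by (auto simp: q_def lookup_mapp when_def in_keys_iff)
  have "q \<in> supported (F - M)" "p - q \<in> supported M"
    using supportedD[OF p(2)] by (auto intro!: supportedI simp: lookup_minus q when_def split: if_splits)
  then show "x \<in> cls ` supported (F - M)"
    using p(1) cls_eq_iff by blast
next
  fix x :: "('x list \<Rightarrow>\<^sub>0 'k) set" assume "x \<in> cls ` supported (F - M)"
  then show "x \<in> cls ` supported F" using supported_mono[of _ "F - M" F] by blast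
qed

lemma has_dim_power:
  assumes "finite L"
  shows "has_dim (Q :: ('k::field, _) module)
    (subspace_power Q (cls ` supported (words_upto 1)) n) (card (words_upto n - M))"
proof -
  have "finite (words_upto n)"
    using finite_lists_length_le[OF assms, of n] by (simp add: lists_eq_set)
  then have "has_dim (Q :: ('k, _) module) (cls ` supported (words_upto n - M)) (card (words_upto n - M))"
    by (intro has_dim_cls) auto
  then show ?thesis
    by (simp only: subspace_power_eq cls_supported_diff)
qed

text \<open>
  The dimension of \<open>V\<^sup>n\<close> counts the words of length at most \<open>n\<close> that survive in the quotient, so
  growth becomes a counting problem on words.
\<close>

lemma exponential_growthI:
  assumes "finite L" "\<beta> > 1" "\<And>n. \<beta> ^ n \<le> real (card (words_upto n - M))"
  shows "exponential_growth (Q :: ('k::field, _) module)"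
  unfolding exponential_growth_def
proof (intro exI[of _ "cls ` supported (words_upto 1)"] conjI)
  show "subspace_of (cls ` supported (words_upto 1)) (Q :: ('k, _) module)"
    by (rule subspace_cls) auto
  show "\<exists>m. has_dim (Q :: ('k, _) module) (cls ` supported (words_upto 1)) m"
    using has_dim_power[OF assms(1), of 1] unfolding subspace_power_eq by blast
  show "\<one>\<^bsub>Q\<^esub> \<in> (cls ` supported (words_upto 1) :: ('x list \<Rightarrow>\<^sub>0 'k) set set)"
    by (auto simp: one_Q one_supported)
  show "alg_generated (Q :: ('k, _) module) (cls ` supported (words_upto 1)) = carrier Q"
    by (rule generated_by_letters)
  show "\<exists>\<beta>::real. \<beta> > 1 \<and> (\<exists>N. \<forall>n\<ge>N. \<exists>m.
      has_dim (Q :: ('k, _) module) (subspace_power Q (cls ` supported (words_upto 1)) n) m \<and> \<beta> ^ n \<le> real m)"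
    using has_dim_power[OF assms(1)] assms(2,3) by blast
qed

end

section \<open>Commutators and free subalgebras\<close>

text \<open>
  Sending every letter but \<open>a\<close> to \<open>0\<close> maps the free algebra to the commutative algebra
  \<open>K[a]\<close>, which kills commutators. In coefficients: \<open>a\<^sup>n = u v\<close> forces \<open>u\<close> and \<open>v\<close> to be powers
  of \<open>a\<close>, and these commute.
\<close>

lemma lookup_commutator_power_word:
  fixes p q :: "'x list \<Rightarrow>\<^sub>0 'k::field"
  shows "Poly_Mapping.lookup (p * q - q * p) (replicate n a) = 0"
proof -
  let ?w = "replicate n a"
  have "w = ?w \<longleftrightarrow> length w = n \<and> set w \<subseteq> {a}" for w
    by (auto intro: replicate_eqI)
  then have swap: "u @ v = ?w \<longleftrightarrow> v @ u = ?w" for u v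
    by auto
  have "p \<in> supported UNIV" "q \<in> supported UNIV" by (auto simp: supported_def)
  then have "Poly_Mapping.lookup (p * q) ?w = Poly_Mapping.lookup (q * p) ?w"
  proof (induction p rule: supported_induct)
    case (single u c)
    from single(2) show ?case
    proof (induction q rule: supported_induct)
      case (single v d)
      then show ?case using swap[of u v] by (simp add: mult_single_words lookup_single when_def mult.commute)
    qed (simp_all add: algebra_simps lookup_add)
  qed (simp_all add: algebra_simps lookup_add)
  then show ?thesis by (simp add: lookup_minus)
qed

text \<open>
  When all words of \<open>p\<close> have the same length, a word splits in only one way into a word of \<open>p\<close>
  and a remainder, so the convolution has a single term.
\<close>

lemma lookup_mult_homogeneous:
  fixes p q :: "'x list \<Rightarrow>\<^sub>0 'k::field"
  assumes "p \<in> supported {w. length w = length u}"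
  shows "Poly_Mapping.lookup (p * q) (u @ v) = Poly_Mapping.lookup p u * Poly_Mapping.lookup q v"
  using assms
proof (induction p rule: supported_induct)
  case (single w c)
  have "q \<in> supported UNIV" by (auto simp: supported_def)
  then show ?case
  proof (induction q rule: supported_induct)
    case (single w' d)
    then show ?case using \<open>w \<in> _\<close> by (auto simp: mult_single_words lookup_single when_def)
  qed (simp_all add: algebra_simps lookup_add)
qed (simp_all add: algebra_simps lookup_add)

text \<open>
  The coefficient of \<open>(y z)\<^sup>n\<close> in the \<open>n\<close>-th power of the commutator is 1.
\<close>

lemma free_commutator_not_nilpotent:
  fixes y z :: 'y
  assumes "y \<noteq> z"
  defines "u \<equiv> word_monom [y] :: 'y list \<Rightarrow>\<^sub>0 'k::field" and "v \<equiv> word_monom [z]"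
  shows "(u * v - v * u) ^ n \<noteq> 0"
proof -
  let ?x = "u * v - v * u"
  have x: "?x = Poly_Mapping.single [y, z] 1 - Poly_Mapping.single [z, y] 1"
    by (simp add: u_def v_def word_monom_def mult_single_words)
  have hom: "?x \<in> supported {w. length w = length [y, z]}"
    unfolding x by (intro supported_diff supported_single) auto
  have coeff: "Poly_Mapping.lookup ?x [y, z] = 1"
    using assms(1) by (simp add: x lookup_minus lookup_single)
  have "Poly_Mapping.lookup (?x ^ n) (concat (replicate n [y, z])) = 1"
  proof (induction n)
    case 0
    show ?case by (simp add: lookup_one zero_list_def)
  next
    case (Suc n)
    then show ?case
      using lookup_mult_homogeneous[OF hom, of "?x ^ n" "concat (replicate n [y, z])"] coeff by simp
  qed
  then show ?thesis by auto
qed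

lemma supported_power:
  fixes p :: "'x list \<Rightarrow>\<^sub>0 'k::field"
  assumes "p \<in> supported F"
  shows "p ^ n \<in> supported {concat ws | ws. length ws = n \<and> set ws \<subseteq> F}"
proof (induction n)
  case 0
  show ?case by (simp add: one_supported)
next
  case (Suc n)
  show ?case unfolding power_Suc
  proof (rule supported_mult[OF assms Suc])
    fix u v assume u: "u \<in> F" and "v \<in> {concat ws | ws. length ws = n \<and> set ws \<subseteq> F}"
    then obtain ws where "v = concat ws" "length ws = n" "set ws \<subseteq> F" by auto
    then show "u @ v \<in> {concat ws | ws. length ws = Suc n \<and> set ws \<subseteq> F}"
      using u by (intro CollectI exI[of _ "u # ws"]) auto
  qed
qed

context extension_closed
begin

text \<open>
  The hypothesis says that the ideal generated by the letters other than \<open>a\<close> is locally nilpotent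
  in the quotient. Modulo this ideal the quotient is generated by \<open>a\<close> alone and hence commutative.
  The commutator of two elements therefore lies in the ideal and is nilpotent, while the
  commutator of two free generators is not.
\<close>

lemma no_free_subalgebra:
  fixes a :: 'x and B :: "('x list \<Rightarrow>\<^sub>0 'k::field) set set"
  assumes nil: "\<And>d. \<exists>n. \<forall>ws. length ws = n \<and> (\<forall>w\<in>set ws. w \<in> lists L \<and> length w \<le> d \<and> \<not> set w \<subseteq> {a})
    \<longrightarrow> concat ws \<in> M"
  shows "\<not> noncomm_free_subalgebra B Q"
proof
  assume "noncomm_free_subalgebra B Q"
  then obtain Y :: "('x list \<Rightarrow>\<^sub>0 'k) set set" and y z h
    where sub: "subring B Q" and yz: "y \<in> Y" "z \<in> Y" "y \<noteq> z"
      and "h \<in> alg_iso (free_algebra Y :: ('k, _) module) (Q\<lparr>carrier := B\<rparr>)"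
    unfolding noncomm_free_subalgebra_def subalgebra_of_def by blast
  then have h: "h \<in> ring_iso (free_algebra Y) (Q\<lparr>carrier := B\<rparr>)" by (simp add: alg_iso_def)
  let ?Y = "supported (lists Y) :: (_ \<Rightarrow>\<^sub>0 'k) set"
  have h_cls: "\<exists>r\<in>supported (lists L). h s = cls r" if "s \<in> ?Y" for s
    using ring_iso_memE(1)[OF h, of s] that subringE(1)[OF sub] by (auto simp: carrier_Q)
  have h_add: "h (s + t) = h s \<oplus>\<^bsub>Q\<^esub> h t" and h_mult: "h (s * t) = h s \<otimes>\<^bsub>Q\<^esub> h t"
    if "s \<in> ?Y" "t \<in> ?Y" for s t
    using ring_iso_memE(2,3)[OF h, of s t] that by auto
  have h_one: "h 1 = cls 1" using ring_iso_memE(4)[OF h] by (simp add: one_Q)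
  have h_inj: "inj_on h ?Y" using ring_iso_memE(5)[OF h] by (simp add: bij_betw_def)
  have h_zero: "h 0 = cls 0"
  proof -
    obtain r where r: "r \<in> supported (lists L)" "h 0 = cls r" using h_cls[of 0] by auto
    then have "cls (r + r) = cls r" using h_add[of 0 0] by (simp add: add_Q)
    then show ?thesis using r by (simp add: cls_eq_iff)
  qed
  define u v where "u = (word_monom [y] :: _ \<Rightarrow>\<^sub>0 'k)" and "v = (word_monom [z] :: _ \<Rightarrow>\<^sub>0 'k)"
  define x where "x = u * v - v * u"
  have uv: "u \<in> ?Y" "v \<in> ?Y" using yz by (auto simp: u_def v_def supported_word)
  then have x: "x \<in> ?Y" by (simp add: x_def)
  obtain p q where p: "p \<in> supported (lists L)" "h u = cls p" and q: "q \<in> supported (lists L)" "h v = cls q"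
    using h_cls uv by meson
  define r where "r = p * q - q * p"
  have r: "r \<in> supported (lists L)" using p q by (simp add: r_def)
  have hx: "h x = cls r"
  proof -
    \<comment> \<open>\<open>h\<close> is only known to respect sums, so the difference is moved to the other side\<close>
    obtain s where s: "s \<in> supported (lists L)" "h x = cls s" using h_cls[OF x] by auto
    have "h (x + v * u) = cls (s + q * p)"
      using x uv s p q by (simp add: h_add h_mult mult_Q add_Q)
    moreover have "h (x + v * u) = cls (p * q)"
      using uv p q by (simp add: x_def h_mult mult_Q)
    ultimately have "cls (s + q * p) = cls (p * q)" by (rule trans[OF sym])
    then show ?thesis using s by (simp add: cls_eq_iff r_def algebra_simps)
  qed
  have pow: "x ^ n \<in> ?Y \<and> r ^ n \<in> supported (lists L) \<and> h (x ^ n) = cls (r ^ n)" for n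
    by (induction n) (use x r hx in \<open>auto simp: h_one one_supported h_mult mult_Q\<close>)
  obtain d where d: "\<And>w. w \<in> Poly_Mapping.keys r \<Longrightarrow> length w \<le> d"
    using finite_nat_set_iff_bounded_le[of "length ` Poly_Mapping.keys r"] by auto
  obtain n where n: "\<And>ws. length ws = n \<Longrightarrow>
      (\<And>w. w \<in> set ws \<Longrightarrow> w \<in> lists L \<and> length w \<le> d \<and> \<not> set w \<subseteq> {a}) \<Longrightarrow> concat ws \<in> M"
    using nil[of d] by blast
  have keys: "w \<in> lists L \<and> length w \<le> d \<and> \<not> set w \<subseteq> {a}" if "w \<in> Poly_Mapping.keys r" for w
  proof (intro conjI notI)
    show "w \<in> lists L" using r that by (auto simp: supported_def)
    show "length w \<le> d" using d that .
    assume "set w \<subseteq> {a}"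
    then have "w = replicate (length w) a" by (intro replicate_eqI) auto
    then have "Poly_Mapping.lookup r w = 0"
      unfolding r_def by (metis lookup_commutator_power_word)
    then show False using that by (simp add: in_keys_iff)
  qed
  have "r ^ n \<in> supported {concat ws | ws. length ws = n \<and> set ws \<subseteq> Poly_Mapping.keys r}"
    by (rule supported_power) (simp add: supported_def)
  moreover have "{concat ws | ws. length ws = n \<and> set ws \<subseteq> Poly_Mapping.keys r} \<subseteq> M"
    using n keys by blast
  ultimately have "r ^ n \<in> supported M" by (rule supported_mono)
  then have "h (x ^ n) = h 0" using pow[of n] by (simp add: h_zero cls_eq_iff)
  then have "x ^ n = 0" using pow[of n] by (intro inj_onD[OF h_inj]) auto
  moreover have "x ^ n \<noteq> 0"
    unfolding x_def u_def v_def by (rule free_commutator_not_nilpotent[OF yz(3)])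
  ultimately show False by simp
qed

end

section \<open>The forced positions\<close>

definition one_positions :: "nat set" where
  "one_positions = (\<Union>k\<in>{1..}. {10 ^ k * n + k - 1 | n. n \<ge> 1})"

text \<open>
  Every multiple \<open>10\<^sup>k t\<close> with \<open>t \<ge> 1\<close> starts a run of \<open>k\<close> consecutive elements: it is also a
  multiple of \<open>10 ^ (j + 1)\<close> for each \<open>j < k\<close>, which puts \<open>10\<^sup>k t + j\<close> into the progression with
  exponent \<open>j + 1\<close>. So runs of any given length recur with bounded gaps.
\<close>

lemma one_positions_run:
  assumes "t \<ge> 1" "j < k"
  shows "10 ^ k * t + j \<in> one_positions"
proof -
  have "10 ^ k = 10 ^ Suc j * (10 ^ (k - Suc j) :: nat)"
    using assms(2) by (simp del: power_Suc flip: power_add)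
  then have "10 ^ k * t + j = 10 ^ Suc j * (10 ^ (k - Suc j) * t) + Suc j - 1" by simp
  moreover have "10 ^ (k - Suc j) * t \<ge> 1" using assms(1) by simp
  ultimately have "10 ^ k * t + j \<in> {10 ^ Suc j * n + Suc j - 1 | n. n \<ge> 1}" by blast
  then show ?thesis unfolding one_positions_def by (rule UN_I[rotated]) simp
qed

lemma geometric_bound: "9 * (\<Sum>k=1..m. real N / 10 ^ k) \<le> real N"
proof -
  have "9 * (\<Sum>k=1..m. real N / 10 ^ k) = real N * (1 - 1 / 10 ^ m)"
    by (induction m) (auto simp: field_simps)
  also have "\<dots> \<le> real N" by (simp add: mult_left_le)
  finally show ?thesis .
qed

text \<open>
  The progressions have densities \<open>1/10, 1/100, \<dots>\<close>, which sum to \<open>1/9\<close>.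
\<close>

lemma card_one_positions_upto: "9 * card (one_positions \<inter> {1..N}) \<le> N"
proof -
  have "one_positions \<inter> {1..N} \<subseteq> (\<Union>k\<in>{1..N}. (\<lambda>n. 10 ^ k * n + k - 1) ` {1..N div 10 ^ k})"
  proof
    fix i assume "i \<in> one_positions \<inter> {1..N}"
    then obtain k n where kn: "k \<ge> 1" "n \<ge> 1" "i = 10 ^ k * n + k - 1" "i \<le> N"
      by (auto simp: one_positions_def)
    have "10 ^ k * n \<le> N" using kn by linarith
    then have "n \<le> N div 10 ^ k" by (simp add: less_eq_div_iff_mult_less_eq mult.commute)
    \<comment> \<open>only finitely many of the progressions meet the interval\<close>
    moreover have "k \<le> N"
    proof -
      have "k < 10 ^ k" by (rule less_exp[of k, THEN order.strict_trans2]) (simp add: power_mono)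
      also have "\<dots> \<le> 10 ^ k * n" using kn(2) by simp
      finally show ?thesis using \<open>10 ^ k * n \<le> N\<close> by simp
    qed
    ultimately show "i \<in> (\<Union>k\<in>{1..N}. (\<lambda>n. 10 ^ k * n + k - 1) ` {1..N div 10 ^ k})"
      using kn by (intro UN_I[of k] image_eqI[of _ _ n]) auto
  qed
  then have "card (one_positions \<inter> {1..N}) \<le> card (\<Union>k\<in>{1..N}. (\<lambda>n. 10 ^ k * n + k - 1) ` {1..N div 10 ^ k})"
    by (intro card_mono) auto
  also have "\<dots> \<le> (\<Sum>k\<in>{1..N}. card ((\<lambda>n. 10 ^ k * n + k - 1) ` {1..N div 10 ^ k}))"
    by (rule card_UN_le) simp
  also have "\<dots> \<le> (\<Sum>k=1..N. N div 10 ^ k)"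
    by (intro sum_mono order.trans[OF card_image_le]) auto
  finally have "real (card (one_positions \<inter> {1..N})) \<le> (\<Sum>k=1..N. real (N div 10 ^ k))"
    by (metis of_nat_le_iff of_nat_sum)
  also have "\<dots> \<le> (\<Sum>k=1..N. real N / 10 ^ k)"
    by (intro sum_mono) (metis of_nat_div_le_of_nat of_nat_numeral of_nat_power)
  finally have "9 * real (card (one_positions \<inter> {1..N})) \<le> real N" using geometric_bound[of N N] by linarith
  then show ?thesis by linarith
qed

section \<open>The forbidden words\<close>

definition admissible :: "(nat \<Rightarrow> nat) \<Rightarrow> bool" where
  "admissible \<epsilon> \<longleftrightarrow> (\<forall>i\<ge>1. \<epsilon> i \<in> {1, 2, 3} \<and> (\<epsilon> i = 1 \<longleftrightarrow> i \<in> one_positions))"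

definition forbidden :: "nat list set" where
  "forbidden = {w \<in> lists {1, 2, 3}. \<not> (\<exists>\<epsilon>. admissible \<epsilon> \<and> factor_of w \<epsilon>)}"

lemma factor_of_middle:
  assumes "factor_of (u @ w @ v) \<epsilon>"
  shows "factor_of w \<epsilon>"
proof -
  obtain p where p: "p \<ge> 1" "u @ w @ v = map \<epsilon> [p..<p + length (u @ w @ v)]"
    using assms by (auto simp: factor_of_def)
  have "w = map \<epsilon> [p + length u..<p + length u + length w]"
  proof (rule nth_equalityI)
    fix i assume i: "i < length w"
    then have "w ! i = (u @ w @ v) ! (length u + i)" by (simp add: nth_append)
    also have "\<dots> = \<epsilon> (p + (length u + i))" using i by (subst p(2)) simp
    finally show "w ! i = map \<epsilon> [p + length u..<p + length u + length w] ! i" using i by (simp add: add.assoc)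
  qed simp
  then show ?thesis using p(1) by (auto simp: factor_of_def intro!: exI[of _ "p + length u"])
qed

interpretation forb: extension_closed "{1, 2, 3}" forbidden
proof
  show "forbidden \<subseteq> lists {1, 2, 3}" unfolding forbidden_def by blast
  fix u v w :: "nat list"
  assume "w \<in> forbidden" "u \<in> lists {1, 2, 3}" "v \<in> lists {1, 2, 3}"
  then show "u @ w @ v \<in> forbidden"
    using factor_of_middle[of u w v] unfolding forbidden_def by (auto simp del: in_lists_conv_set)
qed

text \<open>
  In the prefix of length \<open>n\<close> each position outside the set is free to carry 2 or 3, and different
  choices give different words.
\<close>

lemma card_allowed:
  "2 ^ card ({1..n} - one_positions) \<le> card (forb.words_upto n - forbidden)"
proof -
  define \<epsilon> where "\<epsilon> T i = (if i \<in> one_positions then 1 else if i \<in> T then 2 else 3 :: nat)" for T i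
  define wd where "wd T = map (\<epsilon> T) [1..<1 + n]" for T
  have adm: "admissible (\<epsilon> T)" for T by (auto simp: admissible_def \<epsilon>_def)
  have "inj_on wd (Pow ({1..n} - one_positions))"
  proof (rule inj_onI)
    fix T T' assume T: "T \<in> Pow ({1..n} - one_positions)" "T' \<in> Pow ({1..n} - one_positions)" "wd T = wd T'"
    have "i \<in> T \<longleftrightarrow> i \<in> T'" if "i \<in> {1..n} - one_positions" for i
    proof -
      have "i \<in> set [1..<1 + n]" using that by auto
      then have "\<epsilon> T i = \<epsilon> T' i" using T(3) unfolding wd_def map_eq_conv by (rule bspec[rotated])
      then show ?thesis using that by (auto simp: \<epsilon>_def split: if_splits)
    qed
    then show "T = T'" using T(1,2) by blast
  qed
  moreover have "wd ` Pow ({1..n} - one_positions) \<subseteq> forb.words_upto n - forbidden"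
  proof
    fix w assume "w \<in> wd ` Pow ({1..n} - one_positions)"
    then obtain T where w: "w = wd T" by auto
    have "factor_of w (\<epsilon> T)" unfolding factor_of_def w wd_def by (intro exI[of _ 1]) simp
    then have "w \<notin> forbidden" using adm by (auto simp: forbidden_def)
    moreover have "w \<in> forb.words_upto n" unfolding w wd_def by (auto simp: \<epsilon>_def)
    ultimately show "w \<in> forb.words_upto n - forbidden" by simp
  qed
  moreover have "finite (forb.words_upto n - forbidden)"
    using finite_lists_length_le[of "{1, 2, 3 :: nat}" n] by (simp add: lists_eq_set)
  ultimately have "card (Pow ({1..n} - one_positions)) \<le> card (forb.words_upto n - forbidden)"
    by (rule card_inj_on_le)
  then show ?thesis by (simp add: card_Pow)
qed

lemma allowed_growth: "sqrt 2 ^ n \<le> real (card (forb.words_upto n - forbidden))"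
proof -
  have "card ({1..n} - one_positions) = n - card (one_positions \<inter> {1..n})"
    by (subst card_Diff_subset_Int) (auto simp: Int_commute)
  then have "n \<le> 2 * card ({1..n} - one_positions)" using card_one_positions_upto[of n] by linarith
  then have "sqrt 2 ^ n \<le> sqrt 2 ^ (2 * card ({1..n} - one_positions))" by (intro power_increasing) auto
  also have "\<dots> = real (2 ^ card ({1..n} - one_positions))" by (simp add: power_mult)
  also have "\<dots> \<le> real (card (forb.words_upto n - forbidden))" using card_allowed of_nat_le_iff by blast
  finally show ?thesis .
qed

text \<open>
  A window of length \<open>2d\<close> that starts inside one block has at least \<open>d\<close> places left after that
  block, enough for the whole next block.
\<close>

lemma window_of_blocks:
  assumes "\<And>v. v \<in> set vs \<Longrightarrow> length v \<le> d \<and> \<not> set v \<subseteq> {a}" and "d \<ge> 1"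
    and "i + 2 * d \<le> length (concat vs)"
  shows "\<exists>j. i \<le> j \<and> j < i + 2 * d \<and> concat vs ! j \<noteq> a"
  using assms(1,3)
proof (induction vs arbitrary: i)
  case Nil
  then show ?case using assms(2) by simp
next
  case (Cons v vs)
  show ?case
  proof (cases "length v \<le> i")
    case True
    then have "i - length v + 2 * d \<le> length (concat vs)" using Cons.prems(2) by simp
    from Cons.IH[OF _ this] Cons.prems(1) obtain j where
      j: "i - length v \<le> j" "j < i - length v + 2 * d" "concat vs ! j \<noteq> a" by auto
    then show ?thesis using True by (intro exI[of _ "length v + j"]) (auto simp: nth_append)
  next
    case False
    show ?thesis
    proof (cases vs)
      case Nil
      then show ?thesis using Cons.prems assms(2) by auto
    next
      case (Cons v' vs')
      then have v': "length v' \<le> d" "\<not> set v' \<subseteq> {a}" using Cons.prems(1) by auto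
      then obtain m where m: "m < length v'" "v' ! m \<noteq> a" by (auto simp: in_set_conv_nth subset_eq)
      have "length v \<le> d" using Cons.prems(1) by auto
      then show ?thesis using False m v'(1) Cons
        by (intro exI[of _ "length v + m"]) (auto simp: nth_append)
    qed
  qed
qed

text \<open>
  Any stretch of at least \<open>10\<^sup>k + k\<close> positions contains a whole run of \<open>k\<close> forced ones, beginning
  at a multiple of \<open>10\<^sup>k\<close>. Blocks of length at most \<open>d\<close> that are not powers of 1 leave no room for
  a run of \<open>k = 2d\<close> ones, so a product of too many of them is forbidden.
\<close>

lemma nil_words:
  "\<exists>n. \<forall>ws. length ws = n \<and> (\<forall>w\<in>set ws. w \<in> lists {1, 2, 3} \<and> length w \<le> d \<and> \<not> set w \<subseteq> {1})
    \<longrightarrow> concat ws \<in> forbidden"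
proof (intro exI allI impI, elim conjE)
  fix ws :: "nat list list"
  define k where "k = 2 * d"
  assume len: "length ws = 10 ^ (2 * d) + 2 * d"
    and ws: "\<forall>w\<in>set ws. w \<in> lists {1, 2, 3} \<and> length w \<le> d \<and> \<not> set w \<subseteq> {1}"
  have block: "1 \<le> length w" "length w \<le> d" if "w \<in> set ws" for w
    using ws that by (auto simp: Suc_le_eq)
  have "\<forall>w\<in>set ws. 1 \<le> length w" using block(1) by blast
  then have "length ws \<le> length (concat ws)" by (induction ws) auto
  obtain w where "w \<in> set ws" using len by (cases ws) auto
  then have d: "d \<ge> 1" using block le_trans by blast
  show "concat ws \<in> forbidden"
  proof (rule ccontr)
    assume "concat ws \<notin> forbidden"
    then obtain \<epsilon> p where "admissible \<epsilon>" "p \<ge> 1" and w: "concat ws = map \<epsilon> [p..<p + length (concat ws)]"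
      using ws by (force simp: forbidden_def factor_of_def)
    \<comment> \<open>the first multiple of \<open>10 ^ k\<close> after \<open>p\<close>, and its place in the word\<close>
    define t where "t = p div 10 ^ k + 1"
    define i where "i = 10 ^ k * t - p"
    have "p mod 10 ^ k < 10 ^ k" by simp
    moreover have "10 ^ k * (p div 10 ^ k) + p mod 10 ^ k = p" by simp
    ultimately have i: "i \<le> 10 ^ k" "p + i = 10 ^ k * t" 
      unfolding i_def t_def distrib_left mult_1_right by linarith+
    then have "i + 2 * d \<le> length (concat ws)"
      using len \<open>length ws \<le> length (concat ws)\<close> by (simp add: k_def)
    then obtain j where j: "i \<le> j" "j < i + 2 * d" "concat ws ! j \<noteq> 1"
      using window_of_blocks[of ws d 1 i] ws d by auto
    have "concat ws ! j = \<epsilon> (p + j)"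
      using j \<open>i + 2 * d \<le> length (concat ws)\<close> by (subst w) simp
    moreover have "p + j = 10 ^ k * t + (j - i)" using i j by simp
    moreover have "10 ^ k * t + (j - i) \<in> one_positions" using j by (intro one_positions_run) (auto simp: t_def k_def)
    ultimately show False using \<open>admissible \<epsilon>\<close> \<open>p \<ge> 1\<close> j(3) by (auto simp: admissible_def)
  qed
qed

section \<open>Growth and absence of free subalgebras\<close>

lemma id_alg_iso: "id \<in> alg_iso B B"
  by (auto simp: alg_iso_def ring_iso_def intro!: ring_hom_memI)

theorem proposition6p3:
  fixes S :: "nat set"
    and M :: "nat list set"
    and I :: "(nat list \<Rightarrow>\<^sub>0 'k::field) set"
    and A :: "('k, (nat list \<Rightarrow>\<^sub>0 'k) set) module"
  assumes S_def: "S = (\<Union>k\<in>{1..}. {10 ^ k * n + k - 1 | n. n \<ge> 1})"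
    and M_def: "M = {w \<in> lists {1, 2, 3}.
          \<not> (\<exists>\<epsilon>::nat \<Rightarrow> nat. (\<forall>i\<ge>1. \<epsilon> i \<in> {1, 2, 3} \<and> (\<epsilon> i = 1 \<longleftrightarrow> i \<in> S)) \<and> factor_of w \<epsilon>)}"
    and I_def: "I = Idl\<^bsub>free_algebra {1, 2, 3} :: ('k, _) module\<^esub> (word_monom ` M)"
    and A_def: "A = quot_algebra (free_algebra {1, 2, 3}) I"
  shows "monomial_algebra A \<and> exponential_growth A \<and> (\<nexists>B. noncomm_free_subalgebra B A)"
proof (intro conjI)
  have "M = forbidden"
    unfolding M_def S_def forbidden_def admissible_def one_positions_def ..
  have A: "A = forb.Q"
    unfolding A_def I_def \<open>M = forbidden\<close> forb.Idl_monomials forb.Q_def ..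
  have "monomial_quotient {1..3} forbidden = A"
    unfolding A forb.Q_eq by (rule arg_cong[of _ _ "\<lambda>L. monomial_quotient L forbidden"]) auto
  then have "id \<in> alg_iso (monomial_quotient {1..3} forbidden) A"
    using id_alg_iso by simp
  moreover have "forbidden \<subseteq> lists {1..3}"
  proof -
    have "{1, 2, 3} = {1..3 :: nat}" by auto
    then show ?thesis using forb.M_words by simp
  qed
  ultimately show "monomial_algebra A" unfolding monomial_algebra_def by blast
  show "exponential_growth A"
    unfolding A by (rule forb.exponential_growthI[OF _ _ allowed_growth]) auto
  show "\<nexists>B. noncomm_free_subalgebra B A"
    unfolding A using forb.no_free_subalgebra[OF nil_words] by blast
qed

end
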